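(* Let $d\ge 2$ (in the paper $d\ge3$ is of interest) and let $\prec$ be any strict total order on $\mathbb{Z}$. For $p,q\in\mathbb{Z}^d$ with $p\le q$ coordinatewise, let $S_\prec(p,q)$ be defined as in the context, and set $S_\prec(q,p)=S_\prec(p,q)$. Then this system of segments with strictly positive slope is consistent: (S1) each $S_\prec(p,q)$ is the vertex set of a path from $p$ to $q$ in the grid graph on $\mathbb{Z}^d$; (S2) $S_\prec(p,q)=S_\prec(q,p)$; (S3) for $p\le q$ and every $r\in S_\prec(p,q)$, $S_\prec(p,r)\subseteq S_\prec(p,q)$ and $S_\prec(r,q)\subseteq S_\prec(p,q)$; (S4) for $p\le q$ there is $r\ge q$ with $r\notin S_\prec(p,q)$ and $S_\prec(p,q)\subseteq S_\prec(p,r)$, and there is $r'\le p$ with $r'\notin S_\prec(p,q)$ and $S_\prec(p,q)\subseteq S_\prec(r',q)$; (S5) if $p_i=q_i$ for some $i$, then every $r\in S_\prec(p,q)$ has $r_i=p_i$.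
   Context: The grid graph on $\mathbb{Z}^d$ joins two points iff they differ by exactly $1$ in exactly one coordinate. For $p=(p_1,\dots,p_d)\le q=(q_1,\dots,q_d)$ (coordinatewise), $S_\prec(p,q)$ is the set of points visited by the following walk: start at $p$ and repeatedly move by $+1$ in one coordinate ("direction $i$") until reaching $q$. The segment interval is $I=[p_1+\dots+p_d,\ q_1+\dots+q_d-1]$; partition $I$ according to $\prec$ into consecutive blocks: $I_d$ = the $q_d-p_d$ $\prec$-greatest elements of $I$, $I_{d-1}$ = the $q_{d-1}-p_{d-1}$ $\prec$-greatest elements of $I\setminus I_d$, and so on, down to $I_1$ = the remaining $q_1-p_1$ ($\prec$-smallest) elements. At a point $(r_1,\dots,r_d)$ the walk moves in direction $i$ where $r_1+\dots+r_d\in I_i$. *)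

theory Defs
  imports "HOL-Library.FuncSet"
begin

text \<open>
  Points are extensional functions on the index set \<open>{1..d}\<close>. Because such functions agree outside
  \<open>{1..d}\<close>, the library order \<open>p \<le> q\<close> on functions is, for points, exactly the coordinatewise
  order.
\<close>

definition points :: "nat \<Rightarrow> (nat \<Rightarrow> int) set" where
  "points d = {1..d} \<rightarrow>\<^sub>E UNIV"

lemma points_le_iff:
  assumes "p \<in> points d" "q \<in> points d"
  shows "p \<le> q \<longleftrightarrow> (\<forall>i\<in>{1..d}. p i \<le> q i)"
proof
  assume h: "\<forall>i\<in>{1..d}. p i \<le> q i"
  show "p \<le> q"
  proof (rule le_funI)
    fix i
    show "p i \<le> q i"
    proof (cases "i \<in> {1..d}")
      case True
      then show ?thesis using h by blast
    next
      case False
      then have "p i = undefined" "q i = undefined"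
        using assms PiE_arb[of _ "{1..d}" "\<lambda>_. UNIV" i] unfolding points_def by blast+
      then show ?thesis by simp
    qed
  qed
qed (simp add: le_funD)

definition grid_adj :: "nat \<Rightarrow> (nat \<Rightarrow> int) \<Rightarrow> (nat \<Rightarrow> int) \<Rightarrow> bool" where
  "grid_adj d x y \<longleftrightarrow> x \<in> points d \<and> y \<in> points d \<and>
     (\<exists>i\<in>{1..d}. \<bar>x i - y i\<bar> = 1 \<and> (\<forall>j\<in>{1..d} - {i}. x j = y j))"

definition grid_path :: "nat \<Rightarrow> (nat \<Rightarrow> int) \<Rightarrow> (nat \<Rightarrow> int) \<Rightarrow> (nat \<Rightarrow> int) list \<Rightarrow> bool" where
  "grid_path d p q xs \<longleftrightarrow> xs \<noteq> [] \<and> hd xs = p \<and> last xs = q \<and> distinct xs \<and>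
     set xs \<subseteq> points d \<and> successively (grid_adj d) xs"

definition coord_sum :: "nat \<Rightarrow> (nat \<Rightarrow> int) \<Rightarrow> int" where
  "coord_sum d p = (\<Sum>i=1..d. p i)"

definition segment_interval :: "nat \<Rightarrow> (nat \<Rightarrow> int) \<Rightarrow> (nat \<Rightarrow> int) \<Rightarrow> int set" where
  "segment_interval d p q = {coord_sum d p .. coord_sum d q - 1}"

text \<open>The \<open>k\<close> greatest elements of \<open>A\<close>: those exceeded by fewer than \<open>k\<close> elements of \<open>A\<close>.\<close>

definition greatest_elems :: "('a \<Rightarrow> 'a \<Rightarrow> bool) \<Rightarrow> nat \<Rightarrow> 'a set \<Rightarrow> 'a set" where
  "greatest_elems prec k A = {x \<in> A. card {y \<in> A. prec x y} < k}"

lemma greatest_elems_eq: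
  assumes "irreflp prec" "transp prec" "finite A" "B \<subseteq> A" "card B = k"
    and upper: "\<And>a b. a \<in> A - B \<Longrightarrow> b \<in> B \<Longrightarrow> prec a b"
  shows "greatest_elems prec k A = B"
proof -
  have finB: "finite B" using assms(3,4) finite_subset by blast
  have "card {y \<in> A. prec x y} < k" if "x \<in> B" for x
  proof -
    have irr: "\<not> prec x x" using assms(1) by (rule irreflpD)
    have "y \<in> B - {x}" if y: "y \<in> A" "prec x y" for y
    proof -
      have "\<not> prec y x" using irr transpD[OF assms(2) y(2)] by blast
      then show ?thesis using upper[of y x] y irr \<open>x \<in> B\<close> by blast
    qed
    then have "{y \<in> A. prec x y} \<subseteq> B - {x}" by blast
    then have "card {y \<in> A. prec x y} \<le> card (B - {x})"
      using finB by (simp add: card_mono)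
    also have "\<dots> < card B" using finB that by (rule card_Diff1_less)
    finally show ?thesis using assms(5) by simp
  qed
  moreover have "\<not> card {y \<in> A. prec x y} < k" if "x \<in> A - B" for x
  proof -
    have "B \<subseteq> {y \<in> A. prec x y}" using assms(4) upper that by blast
    then have "card B \<le> card {y \<in> A. prec x y}"
      using assms(3) by (simp add: card_mono)
    then show ?thesis using assms(5) by simp
  qed
  ultimately show ?thesis using assms(4) by (auto simp: greatest_elems_def)
qed

text \<open>What is left of the segment interval after removing the blocks of the last \<open>k\<close> directions
  \<open>d, d - 1, \<dots>, d - k + 1\<close>.\<close>

primrec remaining ::
  "(int \<Rightarrow> int \<Rightarrow> bool) \<Rightarrow> nat \<Rightarrow> (nat \<Rightarrow> int) \<Rightarrow> (nat \<Rightarrow> int) \<Rightarrow> nat \<Rightarrow> int set" where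
  "remaining prec d p q 0 = segment_interval d p q"
| "remaining prec d p q (Suc k) =
     remaining prec d p q k
       - greatest_elems prec (nat (q (d - k) - p (d - k))) (remaining prec d p q k)"

text \<open>The block of direction \<open>i\<close>. For \<open>i = 1\<close> exactly \<open>q 1 - p 1\<close> elements remain, so this block
  consists of all of them.\<close>

definition block ::
  "(int \<Rightarrow> int \<Rightarrow> bool) \<Rightarrow> nat \<Rightarrow> (nat \<Rightarrow> int) \<Rightarrow> (nat \<Rightarrow> int) \<Rightarrow> nat \<Rightarrow> int set" where
  "block prec d p q i = greatest_elems prec (nat (q i - p i)) (remaining prec d p q (d - i))"

inductive_set walk ::
  "(int \<Rightarrow> int \<Rightarrow> bool) \<Rightarrow> nat \<Rightarrow> (nat \<Rightarrow> int) \<Rightarrow> (nat \<Rightarrow> int) \<Rightarrow> (nat \<Rightarrow> int) set"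
  for prec d p q where
  start: "p \<in> walk prec d p q"
| step: "r \<in> walk prec d p q \<Longrightarrow> r \<noteq> q \<Longrightarrow> i \<in> {1..d} \<Longrightarrow> coord_sum d r \<in> block prec d p q i \<Longrightarrow>
     r(i := r i + 1) \<in> walk prec d p q"

text \<open>Segments are only meant for comparable points; for other pairs the value is unspecified.\<close>

definition segment ::
  "(int \<Rightarrow> int \<Rightarrow> bool) \<Rightarrow> nat \<Rightarrow> (nat \<Rightarrow> int) \<Rightarrow> (nat \<Rightarrow> int) \<Rightarrow> (nat \<Rightarrow> int) set" where
  "segment prec d p q =
     (if p \<le> q then walk prec d p q else if q \<le> p then walk prec d q p else undefined)"

end

theory Submission imports Defs begin

text \<open>
  A \<open>\<prec>\<close>-monotone map \<open>L\<close> from an interval of coordinate sums to the directions \<open>{1..d}\<close> is the same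
  thing as a walk: use direction \<open>L k\<close> on leaving level \<open>k\<close>. The blocks of \<open>(p, q)\<close> are the fibres of
  the only monotone labelling with fibre sizes \<open>q i - p i\<close>, so the segments are exactly the walks of
  monotone labellings. Restricting a labelling to a subinterval gives (S3), and (S4) holds because a
  monotone labelling of a finite set extends to one further element.
\<close>

section \<open>Coordinate sums and the walk driven by a labelling\<close>

lemma coord_sum_upd:
  assumes "i \<in> {1..d}"
  shows "coord_sum d (r(i := r i + c)) = coord_sum d r + c"
proof -
  have "coord_sum d (r(i := r i + c)) = (\<Sum>j\<in>{1..d}. r j + (if j = i then c else 0))"
    unfolding coord_sum_def by (rule sum.cong) auto
  then show ?thesis using assms by (simp add: coord_sum_def sum.distrib sum.delta)
qed

lemma points_upd: "r \<in> points d \<Longrightarrow> i \<in> {1..d} \<Longrightarrow> r(i := c) \<in> points d"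
  by (auto simp: points_def PiE_def extensional_def)

lemma coord_sum_mono: "p \<le> q \<Longrightarrow> coord_sum d p \<le> coord_sum d q"
  by (auto simp: coord_sum_def le_fun_def intro: sum_mono)

lemma finite_int_interval_Collect [simp]:
  fixes a b :: int
  shows "finite {x. a \<le> x \<and> x < b \<and> P x}"
  by (rule finite_subset[of _ "{a..<b}"]) auto

text \<open>The point at level \<open>k\<close> of the walk from \<open>p\<close> that leaves each
  level \<open>x\<close> in direction \<open>L x\<close>. Counting past steps instead of recursing
  makes it total in \<open>k\<close> and makes monotonicity and locality in \<open>L\<close>
  immediate; the recursion is recovered in \<open>trace_step\<close>.\<close>

definition trace :: "nat \<Rightarrow> (nat \<Rightarrow> int) \<Rightarrow> (int \<Rightarrow> nat) \<Rightarrow> int \<Rightarrow> nat \<Rightarrow> int" where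
  "trace d p L k = (\<lambda>i. p i + int (card {x \<in> {coord_sum d p..<k}. L x = i}))"

lemma trace_start [simp]: "trace d p L (coord_sum d p) = p"
  by (simp add: trace_def)

lemma trace_step:
  assumes "coord_sum d p \<le> k"
  shows "trace d p L (k + 1) = (trace d p L k)(L k := trace d p L k (L k) + 1)"
proof
  fix i
  have "{x \<in> {coord_sum d p..<k + 1}. L x = i} =
      (if L k = i then insert k {x \<in> {coord_sum d p..<k}. L x = i}
       else {x \<in> {coord_sum d p..<k}. L x = i})"
    using assms by auto (metis less_le zle_add1_eq_le)+
  then show "trace d p L (k + 1) i = ((trace d p L k)(L k := trace d p L k (L k) + 1)) i"
    by (auto simp: trace_def)
qed

lemma trace_mono: "k \<le> m \<Longrightarrow> trace d p L k \<le> trace d p L m"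
  by (auto simp: trace_def le_fun_def intro!: card_mono)

lemma trace_ge: "p \<le> trace d p L k"
  by (auto simp: trace_def le_fun_def)

lemma trace_cong:
  assumes "\<And>x. coord_sum d p \<le> x \<Longrightarrow> x < k \<Longrightarrow> L x = L' x"
  shows "trace d p L k = trace d p L' k"
proof -
  have "{x \<in> {coord_sum d p..<k}. L x = i} = {x \<in> {coord_sum d p..<k}. L' x = i}" for i
    using assms by auto
  then show ?thesis by (simp add: trace_def)
qed

section \<open>Monotone labellings: extension and existence\<close>

locale direction_order =
  fixes prec :: "int \<Rightarrow> int \<Rightarrow> bool" and d :: nat
  assumes irrefl: "irreflp prec" and trans: "transp prec" and total: "totalp prec"
begin

definition labelling :: "int set \<Rightarrow> (int \<Rightarrow> nat) \<Rightarrow> bool" where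
  "labelling A L \<longleftrightarrow> L ` A \<subseteq> {1..d} \<and> (\<forall>a\<in>A. \<forall>b\<in>A. prec a b \<longrightarrow> L a \<le> L b)"

lemma labelling_in: "labelling A L \<Longrightarrow> x \<in> A \<Longrightarrow> L x \<in> {1..d}"
  by (auto simp: labelling_def)

lemma labelling_mono: "labelling A L \<Longrightarrow> a \<in> A \<Longrightarrow> b \<in> A \<Longrightarrow> prec a b \<Longrightarrow> L a \<le> L b"
  by (auto simp: labelling_def)

lemma labelling_subset: "labelling A L \<Longrightarrow> B \<subseteq> A \<Longrightarrow> labelling B L"
  by (auto simp: labelling_def)

text \<open>The new element takes the largest label found \<open>prec\<close>-below it. By
  transitivity everything below \<open>x\<close> is also below everything above \<open>x\<close>, so
  this label does not exceed the labels above.\<close>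

lemma labelling_extend:
  assumes L: "labelling A L" and A: "finite A" "x \<notin> A" and d: "1 \<le> d"
  obtains i where "i \<in> {1..d}" "labelling (insert x A) (L(x := i))"
proof
  \<comment> \<open>The \<open>1\<close> is the default when nothing lies below \<open>x\<close>; as
    the least direction it cannot exceed any label above \<open>x\<close>.\<close>
  let ?M = "insert 1 (L ` {a \<in> A. prec a x})"
  define i where "i = Max ?M"
  have fin: "finite ?M" using A by simp
  have "i \<in> ?M" unfolding i_def by (rule Max_in) (use fin in auto)
  then show i: "i \<in> {1..d}" using d labelling_in[OF L] by auto
  have below: "L a \<le> i" if "a \<in> A" "prec a x" for a
    unfolding i_def using fin that by (intro Max_ge) auto
  have above: "i \<le> L b" if b: "b \<in> A" "prec x b" for b
    unfolding i_def
  proof (rule Max.boundedI)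
    fix y assume "y \<in> ?M"
    then show "y \<le> L b"
      using labelling_in[OF L b(1)] labelling_mono[OF L _ b(1)] transpD[OF trans _ b(2)] by auto
  qed (use fin in auto)
  show "labelling (insert x A) (L(x := i))"
    unfolding labelling_def
    using i below above labelling_in[OF L] labelling_mono[OF L] A(2) irreflpD[OF irrefl] by auto
qed

text \<open>Greedy induction on the size of \<open>A\<close>: the \<open>prec\<close>-greatest
  element receives the largest direction whose prescribed fibre is nonempty, and the rest is
  labelled with that fibre size lowered by one.\<close>

lemma labelling_exists:
  assumes "finite A" "(\<Sum>i=1..d. c i) = card A"
  shows "\<exists>L. labelling A L \<and> (\<forall>i\<in>{1..d}. card {x \<in> A. L x = i} = c i)"
  using assms
proof (induction "card A" arbitrary: A c)
  case 0
  then show ?case by (auto simp: labelling_def)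
next
  case (Suc n)
  have trans_A: "transp_on A prec" and total_A: "totalp_on A prec"
    using trans total by (auto intro: transp_on_subset totalp_on_subset)
  have "A \<noteq> {}" using Suc.hyps(2) by auto
  then obtain m where m: "m \<in> A" and top: "\<And>x. x \<in> A \<Longrightarrow> x \<noteq> m \<Longrightarrow> prec x m"
    using Finite_Set.bex_greatest_element[OF Suc.prems(1) _ trans_A total_A] by blast
  let ?M = "{i \<in> {1..d}. 0 < c i}"
  define i where "i = Max ?M"
  have "?M \<noteq> {}"
  proof
    assume "?M = {}"
    then have "(\<Sum>i=1..d. c i) = 0" by auto
    then show False using Suc.prems Suc.hyps(2) by simp
  qed
  then have i: "i \<in> {1..d}" "0 < c i"
    using Max_in[of ?M] unfolding i_def by auto
  have i_max: "j \<le> i" if "j \<in> {1..d}" "0 < c j" for j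
    unfolding i_def using that by (intro Max_ge) auto
  let ?c = "c(i := c i - 1)"
  have "(\<Sum>j=1..d. c j) = (\<Sum>j=1..d. ?c j) + 1"
  proof -
    have "(\<Sum>j=1..d. c j) = (\<Sum>j=1..d. ?c j + (if j = i then 1 else 0))"
      using i by (intro sum.cong) auto
    then show ?thesis using i by (simp only: sum.distrib) simp
  qed
  then have "(\<Sum>j=1..d. ?c j) = card (A - {m})"
    using Suc.prems m by simp
  moreover have "n = card (A - {m})" using Suc.hyps(2) Suc.prems(1) m by simp
  ultimately obtain L where L: "labelling (A - {m}) L"
      and card_L: "\<And>j. j \<in> {1..d} \<Longrightarrow> card {x \<in> A - {m}. L x = j} = ?c j"
    using Suc.hyps(1)[of "A - {m}" ?c] Suc.prems(1) by auto
  \<comment> \<open>The fibre of \<open>L a\<close> contains \<open>a\<close>, so \<open>L a\<close>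
    has a positive prescribed size and is bounded by the maximal such direction
    \<open>i\<close>.\<close>
  have le_i: "L a \<le> i" if "a \<in> A - {m}" for a
  proof (rule i_max)
    show "L a \<in> {1..d}" using labelling_in[OF L that] .
    have "{x \<in> A - {m}. L x = L a} \<noteq> {}" using that by auto
    then have "0 < card {x \<in> A - {m}. L x = L a}"
      using Suc.prems(1) by (simp add: card_gt_0_iff)
    then show "0 < c (L a)"
      using card_L[OF \<open>L a \<in> {1..d}\<close>] by (auto split: if_splits)
  qed
  \<comment> \<open>As a lower argument of \<open>prec\<close>, \<open>m\<close> never occurs, so
    monotonicity only has to be checked towards \<open>m\<close>, where \<open>le_i\<close>
    applies.\<close>
  have "\<not> prec m x" if "x \<in> A" for x
    using top[OF that] irreflpD[OF irrefl] transpD[OF trans] by metis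
  then have "labelling A (L(m := i))"
    unfolding labelling_def
    using i le_i labelling_in[OF L] labelling_mono[OF L] by auto
  moreover have "card {x \<in> A. (L(m := i)) x = j} = c j" if "j \<in> {1..d}" for j
  proof -
    have "{x \<in> A. (L(m := i)) x = j} =
        (if j = i then insert m {x \<in> A - {m}. L x = j} else {x \<in> A - {m}. L x = j})"
      using m by auto
    then show ?thesis using card_L[OF that] i Suc.prems(1) by auto
  qed
  ultimately show ?case by blast
qed

section \<open>Walks as traces of monotone labellings\<close>

text \<open>Each step raises one genuine coordinate by one, hence also the level. The bound
  \<open>k \<le> t\<close> matters because from \<open>t\<close> on the labels are arbitrary. The
  second conclusion lets the level identify a point of the walk.\<close>

lemma trace_in_points:
  assumes p: "p \<in> points d" and L: "labelling {coord_sum d p..<t} L"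
    and "coord_sum d p \<le> k" "k \<le> t"
  shows "trace d p L k \<in> points d" "coord_sum d (trace d p L k) = k"
proof -
  have "trace d p L k \<in> points d \<and> coord_sum d (trace d p L k) = k"
    using \<open>coord_sum d p \<le> k\<close> \<open>k \<le> t\<close>
  proof (induction k rule: int_ge_induct)
    case base
    then show ?case using p by simp
  next
    case (step k)
    then have "L k \<in> {1..d}" using labelling_in[OF L] by auto
    then show ?case using step by (simp add: trace_step points_upd coord_sum_upd del: fun_upd_apply)
  qed
  then show "trace d p L k \<in> points d" "coord_sum d (trace d p L k) = k" by auto
qed

text \<open>The labels before \<open>k\<close> put the restart point at level \<open>k\<close>; from
  there both sides obey the same recursion.\<close>

lemma trace_trace:
  assumes p: "p \<in> points d" and L: "labelling {coord_sum d p..<k} L"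
    and k: "coord_sum d p \<le> k" and m: "k \<le> m"
  shows "trace d (trace d p L k) L m = trace d p L m"
proof -
  have sum_k: "coord_sum d (trace d p L k) = k" using trace_in_points[OF p L k] by simp
  from m show ?thesis
  proof (induction m rule: int_ge_induct)
    case base
    then show ?case using trace_start[of d "trace d p L k"] sum_k by simp
  next
    case (step m)
    then show ?case using k sum_k by (simp add: trace_step)
  qed
qed

text \<open>Once the blocks of all directions above \<open>j\<close> are removed, exactly the
  elements with label at most \<open>j\<close> remain, and by monotonicity those labelled
  \<open>j\<close> lie on top of them.\<close>

lemma block_eq:
  assumes L: "labelling {coord_sum d p..<t} L" and t: "coord_sum d (trace d p L t) = t"
    and i: "i \<in> {1..d}"
  shows "block prec d p (trace d p L t) i = {x \<in> {coord_sum d p..<t}. L x = i}"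
proof -
  let ?I = "{coord_sum d p..<t}" and ?q = "trace d p L t"
  have top: "greatest_elems prec (nat (?q j - p j)) {x \<in> ?I. L x \<le> j} = {x \<in> ?I. L x = j}" for j
  proof (rule greatest_elems_eq[OF irrefl trans])
    show "card {x \<in> ?I. L x = j} = nat (?q j - p j)" by (simp add: trace_def)
    fix a b
    assume ab: "a \<in> {x \<in> ?I. L x \<le> j} - {x \<in> ?I. L x = j}" "b \<in> {x \<in> ?I. L x = j}"
    \<comment> \<open>Here \<open>L a < j = L b\<close>, so \<open>prec b a\<close> would contradict
      monotonicity; totality then leaves \<open>prec a b\<close>.\<close>
    then have "a \<noteq> b" "\<not> prec b a" using labelling_mono[OF L, of b a] by auto
    then show "prec a b" using totalpD[OF total] by blast
  qed auto
  have rem: "remaining prec d p ?q k = {x \<in> ?I. L x \<le> d - k}" if "k \<le> d" for k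
    using that
  proof (induction k)
    case 0
    then show ?case using labelling_in[OF L] t by (auto simp: segment_interval_def)
  next
    case (Suc k)
    then have "remaining prec d p ?q (Suc k) = {x \<in> ?I. L x \<le> d - k} - {x \<in> ?I. L x = d - k}"
      using top by simp
    \<comment> \<open>Subtraction on naturals truncates, so \<open>Suc k \<le> d\<close> is
      essential: it gives \<open>d - k = Suc (d - Suc k)\<close>.\<close>
    moreover have "a \<le> d - k \<and> a \<noteq> d - k \<longleftrightarrow> a \<le> d - Suc k" for a
      using Suc.prems by linarith
    ultimately show ?case by blast
  qed
  show ?thesis using rem[of "d - i"] top[of i] i by (simp add: block_def)
qed

lemma walk_eq:
  assumes p: "p \<in> points d" and L: "labelling {coord_sum d p..<t} L" and st: "coord_sum d p \<le> t"
  shows "walk prec d p (trace d p L t) = trace d p L ` {coord_sum d p..t}"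
proof (intro equalityI subsetI)
  note sum = trace_in_points(2)[OF p L]
  note blk = block_eq[OF L sum[OF st order_refl]]
  fix r
  show "r \<in> trace d p L ` {coord_sum d p..t}" if "r \<in> walk prec d p (trace d p L t)"
    using that
  proof induction
    case start
    show ?case using st by (intro image_eqI[of _ _ "coord_sum d p"]) auto
  next
    case (step r i)
    then obtain k where k: "coord_sum d p \<le> k" "k \<le> t" "r = trace d p L k" by auto
    \<comment> \<open>The guard \<open>r \<noteq> q\<close> excludes \<open>k = t\<close>, and the
      block containing level \<open>k\<close> determines the direction.\<close>
    with step have "k < t" "L k = i" using sum[of k] blk[of i] by (auto simp: order.order_iff_strict)
    then show ?case using k trace_step[of d p k L] by (intro image_eqI[of _ _ "k + 1"]) auto
  qed
  show "r \<in> walk prec d p (trace d p L t)" if "r \<in> trace d p L ` {coord_sum d p..t}"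
  proof -
    have "trace d p L k \<in> walk prec d p (trace d p L t)" if "coord_sum d p \<le> k" "k \<le> t" for k
      using that
    proof (induction k rule: int_ge_induct)
      case base
      show ?case using walk.start by simp
    next
      case (step k)
      then have k: "k \<in> {coord_sum d p..<t}" by simp
      have "trace d p L k \<noteq> trace d p L t" using sum[of k] sum[of t] step st by auto
      then show ?case
        using walk.step[of "trace d p L k" prec d p _ "L k"] step k labelling_in[OF L k] blk[of "L k"]
        by (simp add: sum trace_step del: fun_upd_apply)
    qed
    then show ?thesis using that by auto
  qed
qed

text \<open>The differences \<open>q i - p i\<close> add up to the length of the level interval, so
  a labelling with these fibre sizes exists, and its trace ends at \<open>q\<close>.\<close>

lemma trace_exists:
  assumes p: "p \<in> points d" and q: "q \<in> points d" and le: "p \<le> q"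
  obtains L where "labelling {coord_sum d p..<coord_sum d q} L" "q = trace d p L (coord_sum d q)"
proof -
  let ?I = "{coord_sum d p..<coord_sum d q}"
  have nonneg: "p i \<le> q i" for i using le by (simp add: le_fun_def)
  have "int (\<Sum>i=1..d. nat (q i - p i)) = coord_sum d q - coord_sum d p"
    using nonneg by (simp add: coord_sum_def sum_subtractf)
  then have "(\<Sum>i=1..d. nat (q i - p i)) = card ?I"
    using coord_sum_mono[OF le] by (simp only: card_atLeastLessThan_int)
  then obtain L where L: "labelling ?I L"
      and card_L: "\<And>i. i \<in> {1..d} \<Longrightarrow> card {x \<in> ?I. L x = i} = nat (q i - p i)"
    using labelling_exists[of ?I "\<lambda>i. nat (q i - p i)"] by auto
  have "q i = trace d p L (coord_sum d q) i" for i
  proof (cases "i \<in> {1..d}")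
    case True
    then show ?thesis using card_L[OF True] nonneg[of i] by (simp add: trace_def)
  next
    case False
    then have "{x \<in> ?I. L x = i} = {}" using labelling_in[OF L] by auto
    \<comment> \<open>Outside \<open>{1..d}\<close> no step is counted and both extensional
      functions are \<open>undefined\<close>.\<close>
    moreover have "p i = q i"
      using False p q PiE_arb[of _ "{1..d}" "\<lambda>_. UNIV" i] unfolding points_def by metis
    ultimately show ?thesis unfolding trace_def by simp
  qed
  then show thesis using that L by blast
qed

lemma walk_is_trace:
  assumes "p \<in> points d" "q \<in> points d" "p \<le> q"
  obtains L where "labelling {coord_sum d p..<coord_sum d q} L" "q = trace d p L (coord_sum d q)"
    "walk prec d p q = trace d p L ` {coord_sum d p..coord_sum d q}"
  using trace_exists[OF assms] walk_eq[OF assms(1)] coord_sum_mono[OF assms(3)] by metis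

section \<open>Paths, subwalks and extensions of walks\<close>

lemma walk_path:
  assumes p: "p \<in> points d" and q: "q \<in> points d" and le: "p \<le> q"
  shows "\<exists>xs. grid_path d p q xs \<and> set xs = walk prec d p q"
proof -
  let ?s = "coord_sum d p" and ?t = "coord_sum d q"
  obtain L where L: "labelling {?s..<?t} L" and qL: "q = trace d p L ?t"
    and walk: "walk prec d p q = trace d p L ` {?s..?t}"
    using walk_is_trace[OF assms] .
  note tr = trace_in_points[OF p L]
  let ?xs = "map (trace d p L) [?s..?t]"
  have st: "?s \<le> ?t" by (rule coord_sum_mono[OF le])
  \<comment> \<open>The level \<open>coord_sum d\<close> is a left inverse of the trace, so no point
    is visited twice.\<close>
  have "inj_on (trace d p L) {?s..?t}"
    using tr(2) by (intro inj_on_inverseI[of _ "coord_sum d"]) auto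
  then have "distinct ?xs" by (simp add: distinct_map)
  moreover have "hd ?xs = p" using st by (simp add: hd_map upto_rec1)
  moreover have "last ?xs = q" using st qL by (simp add: last_map upto_rec2)
  moreover have "set ?xs \<subseteq> points d" using tr(1) by auto
  moreover have "successively (grid_adj d) ?xs"
    unfolding successively_conv_nth
  proof (intro allI impI)
    fix n assume "Suc n < length ?xs"
    then have n: "?s \<le> ?s + int n" "?s + int n + 1 \<le> ?t" by auto
    then have "L (?s + int n) \<in> {1..d}" using labelling_in[OF L] by auto
    then have "grid_adj d (trace d p L (?s + int n)) (trace d p L (?s + int n + 1))"
      unfolding grid_adj_def using tr(1)[of "?s + int n"] tr(1)[of "?s + int n + 1"] n
      by (auto simp: trace_step intro!: bexI[of _ "L (?s + int n)"])
    then show "grid_adj d (?xs ! n) (?xs ! Suc n)" using n by (simp add: algebra_simps)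
  qed
  moreover have "?xs \<noteq> []" using st by simp
  ultimately have "grid_path d p q ?xs" unfolding grid_path_def by blast
  then show ?thesis using walk by (intro exI[of _ ?xs]) simp
qed

text \<open>A point at level \<open>k\<close> cuts the labelling into its restrictions to the levels
  before \<open>k\<close> and from \<open>k\<close> on; both are again monotone and trace the two
  parts of the walk. The order bounds on \<open>r\<close> also serve (S5).\<close>

lemma walk_subwalks:
  assumes p: "p \<in> points d" and q: "q \<in> points d" and le: "p \<le> q" and r: "r \<in> walk prec d p q"
  shows "r \<in> points d" "p \<le> r" "r \<le> q"
    "walk prec d p r \<subseteq> walk prec d p q" "walk prec d r q \<subseteq> walk prec d p q"
proof -
  let ?s = "coord_sum d p" and ?t = "coord_sum d q"
  obtain L where L: "labelling {?s..<?t} L" and qL: "q = trace d p L ?t"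
    and walk: "walk prec d p q = trace d p L ` {?s..?t}"
    using walk_is_trace[OF p q le] .
  obtain k where k: "?s \<le> k" "k \<le> ?t" "r = trace d p L k" using r walk by auto
  note tr = trace_in_points[OF p L k(1,2)]
  show rp: "r \<in> points d" using tr k by simp
  show "p \<le> r" using trace_ge k by simp
  show "r \<le> q" using trace_mono[OF k(2)] k qL by metis
  have Lk: "labelling {?s..<k} L" "labelling {k..<?t} L"
    using k by (auto intro: labelling_subset[OF L])
  show "walk prec d p r \<subseteq> walk prec d p q"
    using walk_eq[OF p Lk(1) k(1)] k walk by auto
  have rest: "trace d r L m = trace d p L m" if "k \<le> m" for m
    using trace_trace[OF p Lk(1) k(1) that] k by simp
  have sum_r: "coord_sum d r = k" using tr k by simp
  \<comment> \<open>By \<open>rest\<close>, \<open>q\<close> is also the end of the trace restarted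
    at \<open>r\<close>, which is the form \<open>walk_eq\<close> requires.\<close>
  have "walk prec d r q = trace d r L ` {k..?t}"
    using walk_eq[OF rp, of ?t L] Lk(2) sum_r k rest[of ?t] qL by simp
  then show "walk prec d r q \<subseteq> walk prec d p q"
    using walk rest k by auto
qed

text \<open>Labelling the additional level \<open>?t\<close> prescribes one more step after
  \<open>q\<close>. Its end is new because its level exceeds every level of the old walk.\<close>

lemma walk_extend_up:
  assumes d: "1 \<le> d" and p: "p \<in> points d" and q: "q \<in> points d" and le: "p \<le> q"
  shows "\<exists>r\<in>points d. q \<le> r \<and> r \<notin> walk prec d p q \<and> walk prec d p q \<subseteq> walk prec d p r"
proof -
  let ?s = "coord_sum d p" and ?t = "coord_sum d q"
  obtain L where L: "labelling {?s..<?t} L" and qL: "q = trace d p L ?t"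
    and walk: "walk prec d p q = trace d p L ` {?s..?t}"
    using walk_is_trace[OF p q le] .
  have st: "?s \<le> ?t" by (rule coord_sum_mono[OF le])
  obtain i where "i \<in> {1..d}" "labelling (insert ?t {?s..<?t}) (L(?t := i))"
    using labelling_extend[OF L, of ?t] d by auto
  moreover have "insert ?t {?s..<?t} = {?s..<?t + 1}" using st by auto
  moreover define L' where "L' = L(?t := i)"
  ultimately have L': "labelling {?s..<?t + 1} L'" by simp
  \<comment> \<open>This includes \<open>k = ?t\<close>, since a trace up to \<open>k\<close> only
    counts labels strictly below \<open>k\<close>.\<close>
  have same: "trace d p L' k = trace d p L k" if "k \<le> ?t" for k
    using that by (intro trace_cong) (auto simp: L'_def)
  define r where "r = trace d p L' (?t + 1)"
  have r: "r \<in> points d" "coord_sum d r = ?t + 1"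
    using trace_in_points[OF p L', of "?t + 1"] st by (auto simp: r_def)
  have "q \<le> r" using trace_mono[of ?t "?t + 1" d p L'] qL same[of ?t] r_def by simp
  moreover have "r \<notin> walk prec d p q"
    using walk trace_in_points(2)[OF p L] r(2) by auto
  moreover have "walk prec d p r = trace d p L' ` {?s..?t + 1}"
    using walk_eq[OF p L'] st by (simp add: r_def)
  then have "walk prec d p q \<subseteq> walk prec d p r"
    using walk by (auto simp: same[symmetric])
  ultimately show ?thesis using r by blast
qed

text \<open>Labelling the level \<open>?s - 1\<close> prescribes a step that arrives at
  \<open>p\<close>; the new start is found by undoing it.\<close>

lemma walk_extend_down:
  assumes d: "1 \<le> d" and p: "p \<in> points d" and q: "q \<in> points d" and le: "p \<le> q"
  shows "\<exists>r\<in>points d. r \<le> p \<and> r \<notin> walk prec d p q \<and> walk prec d p q \<subseteq> walk prec d r q"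
proof -
  let ?s = "coord_sum d p" and ?t = "coord_sum d q"
  obtain L where L: "labelling {?s..<?t} L" and qL: "q = trace d p L ?t"
    and walk: "walk prec d p q = trace d p L ` {?s..?t}"
    using walk_is_trace[OF p q le] .
  have st: "?s \<le> ?t" by (rule coord_sum_mono[OF le])
  obtain i where i: "i \<in> {1..d}" and "labelling (insert (?s - 1) {?s..<?t}) (L(?s - 1 := i))"
    using labelling_extend[OF L, of "?s - 1"] d by auto
  moreover have "insert (?s - 1) {?s..<?t} = {?s - 1..<?t}" using st by auto
  moreover define L' where "L' = L(?s - 1 := i)"
  ultimately have L': "labelling {?s - 1..<?t} L'" by simp
  define r where "r = p(i := p i - 1)"
  have rp: "r \<in> points d" using p i by (simp add: r_def points_upd)
  have sum_r: "coord_sum d r = ?s - 1" using coord_sum_upd[OF i, of p "-1"] by (simp add: r_def)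
  have "trace d r L' (?s - 1) = r" using trace_start[of d r L'] sum_r by simp
  \<comment> \<open>The first step from \<open>r\<close> uses the new label \<open>i\<close> and
    restores the coordinate that was lowered.\<close>
  then have p_eq: "trace d r L' ?s = p"
    using trace_step[of d r "?s - 1" L'] sum_r by (auto simp: L'_def r_def)
  have same: "trace d r L' k = trace d p L k" if "?s \<le> k" for k
  proof -
    \<comment> \<open>The walk from \<open>r\<close> is restarted at level \<open>?s\<close>, where
      it has reached \<open>p\<close>.\<close>
    have "trace d r L' k = trace d p L' k"
      using trace_trace[OF rp, of ?s L' k] labelling_subset[OF L'] that sum_r p_eq st by auto
    also have "\<dots> = trace d p L k" by (intro trace_cong) (auto simp: L'_def)
    finally show ?thesis .
  qed
  have "r \<le> p" by (simp add: r_def le_fun_def)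
  moreover have "r \<notin> walk prec d p q"
    using walk trace_in_points(2)[OF p L] sum_r by auto
  moreover have "walk prec d r q = trace d r L' ` {?s - 1..?t}"
    using walk_eq[OF rp, of ?t L'] L' st sum_r same[OF st] qL by simp
  then have "walk prec d p q \<subseteq> walk prec d r q"
    using walk by (auto simp: same[symmetric])
  ultimately show ?thesis using rp by blast
qed

end

section \<open>Segments of comparable pairs and their consistency\<close>

lemma grid_adj_commute: "grid_adj d x y \<longleftrightarrow> grid_adj d y x"
  unfolding grid_adj_def by (subst abs_minus_commute) (metis (no_types))

lemma grid_path_rev:
  assumes "grid_path d p q xs"
  shows "grid_path d q p (rev xs)"
proof -
  have "successively (grid_adj d) xs" using assms by (simp add: grid_path_def)
  then have "successively (\<lambda>x y. grid_adj d y x) xs"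
    by (rule successively_mono) (simp add: grid_adj_commute)
  then show ?thesis using assms by (simp add: grid_path_def hd_rev last_rev)
qed

lemma segment_up: "p \<le> q \<Longrightarrow> segment prec d p q = walk prec d p q"
  by (simp add: segment_def)

lemma segment_commute: "p \<le> q \<or> q \<le> p \<Longrightarrow> segment prec d p q = segment prec d q p"
  by (auto simp: segment_def dest: order_antisym)

theorem theorem7:
  fixes prec :: "int \<Rightarrow> int \<Rightarrow> bool" and d :: nat
  assumes "d \<ge> 2"
    and "irreflp prec" and "transp prec" and "totalp prec"
  shows
    "(\<forall>p\<in>points d. \<forall>q\<in>points d. p \<le> q \<or> q \<le> p \<longrightarrow>
        (\<exists>xs. grid_path d p q xs \<and> set xs = segment prec d p q)) \<and>
     (\<forall>p\<in>points d. \<forall>q\<in>points d. p \<le> q \<or> q \<le> p \<longrightarrow>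
        segment prec d p q = segment prec d q p) \<and>
     (\<forall>p\<in>points d. \<forall>q\<in>points d. p \<le> q \<longrightarrow>
        (\<forall>r\<in>segment prec d p q.
           segment prec d p r \<subseteq> segment prec d p q \<and>
           segment prec d r q \<subseteq> segment prec d p q)) \<and>
     (\<forall>p\<in>points d. \<forall>q\<in>points d. p \<le> q \<longrightarrow>
        (\<exists>r\<in>points d. q \<le> r \<and> r \<notin> segment prec d p q \<and>
           segment prec d p q \<subseteq> segment prec d p r) \<and>
        (\<exists>r'\<in>points d. r' \<le> p \<and> r' \<notin> segment prec d p q \<and>
           segment prec d p q \<subseteq> segment prec d r' q)) \<and>
     (\<forall>p\<in>points d. \<forall>q\<in>points d. p \<le> q \<or> q \<le> p \<longrightarrow>
        (\<forall>i\<in>{1..d}. p i = q i \<longrightarrow> (\<forall>r\<in>segment prec d p q. r i = p i)))"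
proof -
  interpret direction_order prec d using assms by unfold_locales
  have d: "1 \<le> d" using assms(1) by simp
  have S1: "\<exists>xs. grid_path d p q xs \<and> set xs = segment prec d p q"
    if pq: "p \<in> points d" "q \<in> points d" "p \<le> q \<or> q \<le> p" for p q
    using pq(3)
  proof
    assume "p \<le> q"
    then show ?thesis using walk_path pq by (simp add: segment_up)
  next
    assume "q \<le> p"
    then obtain xs where "grid_path d q p xs" "set xs = segment prec d p q"
      using walk_path[of q p] pq segment_up segment_commute by metis
    \<comment> \<open>For \<open>q \<le> p\<close> the segment is walked upwards from
      \<open>q\<close>; the reversed list is the path from \<open>p\<close>.\<close>
    then show ?thesis using grid_path_rev by (intro exI[of _ "rev xs"]) auto
  qed
  have S3: "segment prec d p r \<subseteq> segment prec d p q \<and> segment prec d r q \<subseteq> segment prec d p q"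
    if "p \<in> points d" "q \<in> points d" "p \<le> q" "r \<in> segment prec d p q" for p q r
    using walk_subwalks[of p q r] that by (simp add: segment_up)
  have up: "\<exists>r\<in>points d. q \<le> r \<and> r \<notin> segment prec d p q \<and> segment prec d p q \<subseteq> segment prec d p r"
    if "p \<in> points d" "q \<in> points d" "p \<le> q" for p q
    using walk_extend_up[OF d that] that(3) segment_up order_trans by metis
  have down: "\<exists>r\<in>points d. r \<le> p \<and> r \<notin> segment prec d p q \<and> segment prec d p q \<subseteq> segment prec d r q"
    if "p \<in> points d" "q \<in> points d" "p \<le> q" for p q
    using walk_extend_down[OF d that] that(3) segment_up order_trans by metis
  \<comment> \<open>The point \<open>r\<close> lies coordinatewise between the endpoints, so an
    equal coordinate of both squeezes \<open>r i\<close>.\<close>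
  have S5: "r i = p i" if pq: "p \<in> points d" "q \<in> points d" "p \<le> q \<or> q \<le> p"
    and eq: "p i = q i" and r: "r \<in> segment prec d p q" for p q r i
    using pq(3)
  proof
    assume le: "p \<le> q"
    then have "p \<le> r" "r \<le> q" using walk_subwalks[OF pq(1,2) le] r segment_up by metis+
    then show ?thesis using eq by (metis le_funD order_antisym)
  next
    assume le: "q \<le> p"
    then have "q \<le> r" "r \<le> p"
      using walk_subwalks[OF pq(2,1) le] r segment_up segment_commute pq(3) by metis+
    then show ?thesis using eq by (metis le_funD order_antisym)
  qed
  show ?thesis
  proof (intro conjI ballI impI)
    fix p q r
    assume "p \<in> points d" "q \<in> points d" "p \<le> q" "r \<in> segment prec d p q"
    then show "segment prec d p r \<subseteq> segment prec d p q" "segment prec d r q \<subseteq> segment prec d p q"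
      using S3 by auto
  qed (rule S1 segment_commute up down S5; assumption)+
qed

end
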